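(* Let $X$ be a topological space, let $H$ be a subset of $\pi_1(X,x)$, and let $\lambda:I\to X$ be a path from $x$ to $y$. Then $\pi_H^{qs}(X,x)\cong\pi_{\lambda^{-1}H\lambda}^{qs}(X,y)$. In particular, $\pi_1^{qs}(X,x)\cong\pi_1^{qs}(X,y)$ for all $x$ and $y$ belonging to a path component of $X$.
   Context: All topological spaces are assumed to be path connected. $\cong$ denotes group isomorphism. $I=[0,1]$, $\dot I=\{0,1\}$; $\simeq$ rel $\dot I$ denotes homotopy of paths relative to endpoints, and $[f]$ is the homotopy class of a path $f$ rel $\dot I$. $*$ is concatenation of paths, $\lambda^{-1}$ is the reverse path, $c_x$ is the constant path at $x$. $\lambda^{-1}H\lambda=\{[\lambda^{-1}*h*\lambda] : [h]\in H\}\subseteq\pi_1(X,y)$. Closeness: let $f,g:I\to X$ be paths with $f(0)=g(0)$ and $f(1)=g(1)$. We say $f$ is homotopically close to $g$ rel $\dot I$ (written $f\xrightarrow{close} g$ rel $\dot I$) if for every partition $0=t_0<t_1<\cdots<t_n=1$ and every sequence of open sets $U_1,\ldots,U_n$ of $X$ with $g([t_{i-1},t_i])\subset U_i$ for all $i$, there is a path $\gamma$ with $\gamma([t_{i-1},t_i])\subset U_i$ for $1\le i\le n$, $\gamma(t_i)=g(t_i)$ for $0\le i\le n$, and $\gamma\simeq f$ rel $\dot I$. For a subset $H\subseteq\pi_1(X,x)$, $\pi_H^{qs}(X,x)=\{[f]\in\pi_1(X,x) : f\xrightarrow{close} h \text{ rel } \dot I \text{ for some loop } h \text{ at } x \text{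 with } [h]\in H\}$; it is called the $H$-quasi-small loop group of $(X,x)$. For the trivial subgroup $H=\{[c_x]\}$, it is written $\pi_1^{qs}(X,x)$ and called the quasi-small loop group of $(X,x)$. *)

theory Defs
  imports "HOL-Analysis.Analysis" "HOL-Algebra.Group"
begin

text \<open>
  A topological space is a subset \<open>X\<close> of a type of class \<open>topological_space\<close>, carrying the subspace
  topology; \<open>X = UNIV\<close> gives the type itself. Paths are total functions on \<open>real\<close>, of which only the
  restriction to \<open>{0..1}\<close> matters: by \<open>homotopic_paths_eq\<close>, two paths that agree on \<open>{0..1}\<close>
  have the same class.
\<close>

definition loops_at :: "'a::topological_space set \<Rightarrow> 'a \<Rightarrow> (real \<Rightarrow> 'a) set" where
  "loops_at X x = {f. path f \<and> path_image f \<subseteq> X \<and> pathstart f = x \<and> pathfinish f = x}"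

definition path_class :: "'a::topological_space set \<Rightarrow> (real \<Rightarrow> 'a) \<Rightarrow> (real \<Rightarrow> 'a) set" where
  "path_class X f = {g. homotopic_paths X f g}"

text \<open>
  The product of two classes is the union of the classes of all \<open>f +++ g\<close> with \<open>f\<close>, \<open>g\<close> taken from
  the factors; on loop classes these all coincide (\<open>mult_path_class\<close> below).
\<close>

definition fundamental_group ::
    "'a::topological_space set \<Rightarrow> 'a \<Rightarrow> (real \<Rightarrow> 'a) set monoid" where
  "fundamental_group X x =
     \<lparr>carrier = path_class X ` loops_at X x,
      mult = (\<lambda>A B. \<Union>f\<in>A. \<Union>g\<in>B. path_class X (f +++ g)),
      one = path_class X (\<lambda>_. x)\<rparr>"

definition homotopically_close ::
    "'a::topological_space set \<Rightarrow> (real \<Rightarrow> 'a) \<Rightarrow> (real \<Rightarrow> 'a) \<Rightarrow> bool" where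
  "homotopically_close X f g \<longleftrightarrow>
     path f \<and> path_image f \<subseteq> X \<and> path g \<and> path_image g \<subseteq> X \<and>
     pathstart f = pathstart g \<and> pathfinish f = pathfinish g \<and>
     (\<forall>(n::nat) (t::nat \<Rightarrow> real) (U::nat \<Rightarrow> 'a set).
        t 0 = 0 \<and> t n = 1 \<and> (\<forall>i\<in>{1..n}. t (i - 1) < t i) \<and>
        (\<forall>i\<in>{1..n}. openin (top_of_set X) (U i) \<and> g ` {t (i - 1)..t i} \<subseteq> U i) \<longrightarrow>
        (\<exists>\<gamma>. path \<gamma> \<and> path_image \<gamma> \<subseteq> X \<and>
             (\<forall>i\<in>{1..n}. \<gamma> ` {t (i - 1)..t i} \<subseteq> U i) \<and>
             (\<forall>i\<in>{0..n}. \<gamma> (t i) = g (t i)) \<and>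
             homotopic_paths X \<gamma> f))"

definition quasi_small_loops ::
    "'a::topological_space set \<Rightarrow> 'a \<Rightarrow> (real \<Rightarrow> 'a) set set \<Rightarrow> (real \<Rightarrow> 'a) set set" where
  "quasi_small_loops X x H =
     {path_class X f | f. f \<in> loops_at X x \<and>
        (\<exists>h \<in> loops_at X x. path_class X h \<in> H \<and> homotopically_close X f h)}"

text \<open>
  The \<open>H\<close>-quasi-small loops with the multiplication inherited from the fundamental group. This is a
  group if \<open>H\<close> is a subgroup (\<open>group_quasi_small_loop_group\<close> below); for an arbitrary subset \<open>H\<close> the
  carrier need not be closed under the multiplication.
\<close>

definition quasi_small_loop_group ::
    "'a::topological_space set \<Rightarrow> 'a \<Rightarrow> (real \<Rightarrow> 'a) set set \<Rightarrow> (real \<Rightarrow> 'a) set monoid" where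
  "quasi_small_loop_group X x H =
     (fundamental_group X x)\<lparr>carrier := quasi_small_loops X x H\<rparr>"

definition conjugate_by_path ::
    "'a::topological_space set \<Rightarrow> 'a \<Rightarrow> (real \<Rightarrow> 'a) \<Rightarrow> (real \<Rightarrow> 'a) set set \<Rightarrow> (real \<Rightarrow> 'a) set set" where
  "conjugate_by_path X x l H =
     {path_class X (reversepath l +++ (h +++ l)) | h. h \<in> loops_at X x \<and> path_class X h \<in> H}"


subsection \<open>The fundamental group is a group\<close>

text \<open>
  The library proves the unit and inverse laws using constant \<open>linepath\<close>s, hence only in normed spaces.
  The general case follows by composing with the identity path of \<open>{0..1}\<close>.
\<close>

lemma homotopic_paths_rid_const:
  fixes p :: "real \<Rightarrow> 'a::topological_space"
  assumes "path p" "path_image p \<subseteq> X" "x = pathfinish p"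
  shows "homotopic_paths X (p +++ (\<lambda>_. x)) p"
proof -
  have "homotopic_paths {0..1} (linepath 0 1 +++ linepath 1 1) (linepath 0 (1::real))"
    by (rule homotopic_paths_rid') (auto simp: path_image_linepath closed_segment_eq_real_ivl)
  then have "homotopic_paths X (p \<circ> (linepath 0 1 +++ linepath 1 1)) (p \<circ> linepath 0 1)"
    by (rule homotopic_paths_continuous_image) (use assms in \<open>auto simp: path_def path_image_def\<close>)
  moreover have "p \<circ> (linepath 0 1 +++ linepath 1 1) = p +++ (\<lambda>_. x)" "p \<circ> linepath 0 1 = p"
    using assms by (auto simp: linepath_def joinpaths_def pathfinish_def fun_eq_iff)
  ultimately show ?thesis by simp
qed

lemma homotopic_paths_lid_const:
  fixes p :: "real \<Rightarrow> 'a::topological_space"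
  assumes "path p" "path_image p \<subseteq> X" "x = pathstart p"
  shows "homotopic_paths X ((\<lambda>_. x) +++ p) p"
proof -
  have "homotopic_paths {0..1} (linepath 0 0 +++ linepath 0 1) (linepath 0 (1::real))"
    by (rule homotopic_paths_lid') (auto simp: path_image_linepath closed_segment_eq_real_ivl)
  then have "homotopic_paths X (p \<circ> (linepath 0 0 +++ linepath 0 1)) (p \<circ> linepath 0 1)"
    by (rule homotopic_paths_continuous_image) (use assms in \<open>auto simp: path_def path_image_def\<close>)
  moreover have "p \<circ> (linepath 0 0 +++ linepath 0 1) = (\<lambda>_. x) +++ p" "p \<circ> linepath 0 1 = p"
    using assms by (auto simp: linepath_def joinpaths_def pathstart_def fun_eq_iff)
  ultimately show ?thesis by simp
qed

lemma homotopic_paths_linv_const: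
  fixes p :: "real \<Rightarrow> 'a::topological_space"
  assumes "path p" "path_image p \<subseteq> X" "x = pathfinish p"
  shows "homotopic_paths X (reversepath p +++ p) (\<lambda>_. x)"
proof -
  have "homotopic_paths {0..1} (reversepath (linepath 0 1) +++ linepath 0 1)
          (linepath (pathfinish (linepath 0 1)) (pathfinish (linepath 0 (1::real))))"
    by (rule homotopic_paths_linv) (auto simp: path_image_linepath closed_segment_eq_real_ivl)
  then have "homotopic_paths X (p \<circ> (reversepath (linepath 0 1) +++ linepath 0 1))
               (p \<circ> linepath (pathfinish (linepath 0 1)) (pathfinish (linepath 0 1)))"
    by (rule homotopic_paths_continuous_image) (use assms in \<open>auto simp: path_def path_image_def\<close>)
  moreover have "p \<circ> (reversepath (linepath 0 1) +++ linepath 0 1) = reversepath p +++ p"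
    "p \<circ> linepath (pathfinish (linepath 0 1)) (pathfinish (linepath 0 1)) = (\<lambda>_. x)"
    using assms by (auto simp: linepath_def joinpaths_def reversepath_def pathfinish_def fun_eq_iff)
  ultimately show ?thesis by simp
qed

lemma path_class_eq_iff:
  assumes "path f" "path_image f \<subseteq> X"
  shows "path_class X f = path_class X g \<longleftrightarrow> homotopic_paths X f g"
proof
  have "f \<in> path_class X f"
    using assms by (simp add: path_class_def)
  moreover assume "path_class X f = path_class X g"
  ultimately have "f \<in> path_class X g"
    by simp
  then show "homotopic_paths X f g"
    by (simp add: path_class_def homotopic_paths_sym)
next
  assume "homotopic_paths X f g"
  then show "path_class X f = path_class X g"
    unfolding path_class_def using homotopic_paths_sym homotopic_paths_trans by blast
qed

lemma path_class_cong: "homotopic_paths X f g \<Longrightarrow> path_class X f = path_class X g"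
  unfolding path_class_def using homotopic_paths_sym homotopic_paths_trans by blast

lemma loops_at_join: "f \<in> loops_at X x \<Longrightarrow> g \<in> loops_at X x \<Longrightarrow> f +++ g \<in> loops_at X x"
  by (auto simp: loops_at_def path_image_join)

lemma loops_at_reversepath: "f \<in> loops_at X x \<Longrightarrow> reversepath f \<in> loops_at X x"
  by (auto simp: loops_at_def)

lemma loops_at_const: "x \<in> X \<Longrightarrow> (\<lambda>_. x) \<in> loops_at X x"
  by (auto simp: loops_at_def path_def path_image_def pathstart_def pathfinish_def)

lemma mult_path_class:
  assumes "f \<in> loops_at X x" "g \<in> loops_at X x"
  shows "path_class X f \<otimes>\<^bsub>fundamental_group X x\<^esub> path_class X g = path_class X (f +++ g)"
proof -
  have eq: "path_class X (f' +++ g') = path_class X (f +++ g)"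
    if "f' \<in> path_class X f" "g' \<in> path_class X g" for f' g'
    using that assms
    by (intro path_class_cong homotopic_paths_sym[OF homotopic_paths_join])
       (auto simp: path_class_def loops_at_def)
  have "f \<in> path_class X f" "g \<in> path_class X g"
    using assms by (auto simp: path_class_def loops_at_def)
  then have ne: "path_class X f \<noteq> {}" "path_class X g \<noteq> {}"
    by blast+
  have "path_class X f \<otimes>\<^bsub>fundamental_group X x\<^esub> path_class X g =
      (\<Union>f'\<in>path_class X f. \<Union>g'\<in>path_class X g. path_class X (f' +++ g'))"
    by (simp add: fundamental_group_def)
  also have "\<dots> = (\<Union>f'\<in>path_class X f. \<Union>g'\<in>path_class X g. path_class X (f +++ g))"
    by (intro SUP_cong refl) (rule eq)
  also have "\<dots> = path_class X (f +++ g)"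
    using ne by simp
  finally show ?thesis .
qed

lemma group_fundamental_group:
  assumes "x \<in> X"
  shows "group (fundamental_group X x)"
proof (rule groupI)
  show "\<one>\<^bsub>fundamental_group X x\<^esub> \<in> carrier (fundamental_group X x)"
    using loops_at_const[OF assms] by (simp add: fundamental_group_def)
next
  fix A B assume "A \<in> carrier (fundamental_group X x)" "B \<in> carrier (fundamental_group X x)"
  then obtain f g where fg: "f \<in> loops_at X x" "A = path_class X f"
      "g \<in> loops_at X x" "B = path_class X g"
    by (auto simp: fundamental_group_def)
  show "A \<otimes>\<^bsub>fundamental_group X x\<^esub> B \<in> carrier (fundamental_group X x)"
    using fg loops_at_join[of f X x g] by (simp add: mult_path_class) (simp add: fundamental_group_def)
next
  fix A B C assume "A \<in> carrier (fundamental_group X x)" "B \<in> carrier (fundamental_group X x)"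
    "C \<in> carrier (fundamental_group X x)"
  then obtain f g h where fgh: "f \<in> loops_at X x" "A = path_class X f"
      "g \<in> loops_at X x" "B = path_class X g" "h \<in> loops_at X x" "C = path_class X h"
    by (auto simp: fundamental_group_def)
  have "path_class X ((f +++ g) +++ h) = path_class X (f +++ (g +++ h))"
    using fgh by (intro path_class_cong homotopic_paths_sym[OF homotopic_paths_assoc])
      (auto simp: loops_at_def)
  with fgh show "A \<otimes>\<^bsub>fundamental_group X x\<^esub> B \<otimes>\<^bsub>fundamental_group X x\<^esub> C =
      A \<otimes>\<^bsub>fundamental_group X x\<^esub> (B \<otimes>\<^bsub>fundamental_group X x\<^esub> C)"
    by (simp add: mult_path_class loops_at_join)
next
  fix A assume "A \<in> carrier (fundamental_group X x)"
  then obtain f where f: "f \<in> loops_at X x" "A = path_class X f"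
    by (auto simp: fundamental_group_def)
  have one: "\<one>\<^bsub>fundamental_group X x\<^esub> = path_class X (\<lambda>_. x)"
    by (simp add: fundamental_group_def)
  have "path_class X ((\<lambda>_. x) +++ f) = path_class X f"
    using f by (intro path_class_cong homotopic_paths_lid_const) (auto simp: loops_at_def)
  with f show "\<one>\<^bsub>fundamental_group X x\<^esub> \<otimes>\<^bsub>fundamental_group X x\<^esub> A = A"
    by (simp add: one mult_path_class loops_at_const assms)
  have "path_class X (reversepath f +++ f) = path_class X (\<lambda>_. x)"
    using f by (intro path_class_cong homotopic_paths_linv_const) (auto simp: loops_at_def)
  then have "path_class X (reversepath f) \<otimes>\<^bsub>fundamental_group X x\<^esub> A = \<one>\<^bsub>fundamental_group X x\<^esub>"
    using f by (simp add: one mult_path_class loops_at_reversepath)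
  moreover have "path_class X (reversepath f) \<in> carrier (fundamental_group X x)"
    using loops_at_reversepath[OF f(1)] by (simp add: fundamental_group_def)
  ultimately show "\<exists>B\<in>carrier (fundamental_group X x).
      B \<otimes>\<^bsub>fundamental_group X x\<^esub> A = \<one>\<^bsub>fundamental_group X x\<^esub>"
    by blast
qed

lemma inv_path_class:
  assumes "f \<in> loops_at X x"
  shows "inv\<^bsub>fundamental_group X x\<^esub> (path_class X f) = path_class X (reversepath f)"
proof -
  have "x \<in> X"
    using assms by (auto simp: loops_at_def)
  then interpret group "fundamental_group X x"
    by (rule group_fundamental_group)
  have "path_class X (reversepath f +++ f) = path_class X (\<lambda>_. x)"
    using assms by (intro path_class_cong homotopic_paths_linv_const) (auto simp: loops_at_def)
  then have "path_class X (reversepath f) \<otimes>\<^bsub>fundamental_group X x\<^esub> path_class X f = \<one>\<^bsub>fundamental_group X x\<^esub>"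
    using assms by (simp add: mult_path_class loops_at_reversepath) (simp add: fundamental_group_def)
  then show ?thesis
    using assms loops_at_reversepath[OF assms]
    by (intro inv_equality) (auto simp: fundamental_group_def)
qed


subsection \<open>The quasi-small loop group of a subgroup is a group\<close>

lemma homotopically_closeD:
  fixes n :: nat and t :: "nat \<Rightarrow> real"
  assumes close: "homotopically_close X f g"
    and t: "t 0 = 0 \<and> t n = 1 \<and> (\<forall>i\<in>{1..n}. t (i - 1) < t i)"
    and U: "\<forall>i\<in>{1..n}. openin (top_of_set X) (U i) \<and> g ` {t (i - 1)..t i} \<subseteq> U i"
  shows "\<exists>\<gamma>. path \<gamma> \<and> path_image \<gamma> \<subseteq> X \<and> (\<forall>i\<in>{1..n}. \<gamma> ` {t (i - 1)..t i} \<subseteq> U i) \<and>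
             (\<forall>i\<in>{0..n}. \<gamma> (t i) = g (t i)) \<and> homotopic_paths X \<gamma> f"
proof -
  have prem: "t 0 = 0 \<and> t n = 1 \<and> (\<forall>i\<in>{1..n}. t (i - 1) < t i) \<and>
      (\<forall>i\<in>{1..n}. openin (top_of_set X) (U i) \<and> g ` {t (i - 1)..t i} \<subseteq> U i)"
    using t U by simp
  show ?thesis
    using close unfolding homotopically_close_def
    by (elim conjE) (drule spec[of _ n], drule spec[of _ t], drule spec[of _ U], erule mp, rule prem)
qed

lemma homotopically_close_refl:
  "path f \<Longrightarrow> path_image f \<subseteq> X \<Longrightarrow> homotopically_close X f f"
  unfolding homotopically_close_def by (intro conjI allI impI exI[of _ f]) simp_all

lemma homotopically_close_reversepath:
  assumes "homotopically_close X f h"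
  shows "homotopically_close X (reversepath f) (reversepath h)"
  unfolding homotopically_close_def
proof (intro conjI allI impI)
  show "path (reversepath f)" "path_image (reversepath f) \<subseteq> X"
    "path (reversepath h)" "path_image (reversepath h) \<subseteq> X"
    "pathstart (reversepath f) = pathstart (reversepath h)"
    "pathfinish (reversepath f) = pathfinish (reversepath h)"
    using assms by (auto simp: homotopically_close_def)
next
  fix n :: nat and t :: "nat \<Rightarrow> real" and U :: "nat \<Rightarrow> 'a set"
  assume A: "t 0 = 0 \<and> t n = 1 \<and> (\<forall>i\<in>{1..n}. t (i - 1) < t i) \<and>
        (\<forall>i\<in>{1..n}. openin (top_of_set X) (U i) \<and> reversepath h ` {t (i - 1)..t i} \<subseteq> U i)"
  define s where "s i = 1 - t (n - i)" for i
  define V where "V i = U (Suc n - i)" for i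
  have s: "s 0 = 0 \<and> s n = 1 \<and> (\<forall>i\<in>{1..n}. s (i - 1) < s i)"
  proof (intro conjI ballI)
    fix i assume i: "i \<in> {1..n}"
    then have "n - (i - 1) \<in> {1..n}" "n - (i - 1) - 1 = n - i"
      by auto
    with A show "s (i - 1) < s i"
      unfolding s_def by (metis diff_strict_left_mono)
  qed (use A in \<open>auto simp: s_def\<close>)
  have V: "openin (top_of_set X) (V i) \<and> h ` {s (i - 1)..s i} \<subseteq> V i" if i: "i \<in> {1..n}" for i
  proof -
    define j where "j = Suc n - i"
    have j: "j \<in> {1..n}" "n - (i - 1) = j" "n - i = j - 1"
      using i by (auto simp: j_def)
    have "h r \<in> U j" if "r \<in> {s (i - 1)..s i}" for r
    proof -
      have "1 - r \<in> {t (j - 1)..t j}"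
        using that j by (auto simp: s_def)
      then have "reversepath h (1 - r) \<in> U j"
        using A j(1) by blast
      then show ?thesis by (simp add: reversepath_def)
    qed
    then show ?thesis
      using A j(1) by (auto simp: V_def j_def)
  qed
  then have allV: "\<forall>i\<in>{1..n}. openin (top_of_set X) (V i) \<and> h ` {s (i - 1)..s i} \<subseteq> V i"
    by blast
  obtain \<gamma> where g: "path \<gamma>" "path_image \<gamma> \<subseteq> X" "\<forall>i\<in>{1..n}. \<gamma> ` {s (i - 1)..s i} \<subseteq> V i"
      "\<forall>i\<in>{0..n}. \<gamma> (s i) = h (s i)" "homotopic_paths X \<gamma> f"
    using homotopically_closeD[of X f h s n V, OF assms s allV]
    by (elim exE conjE) (rule that)
  show "\<exists>\<gamma>. path \<gamma> \<and> path_image \<gamma> \<subseteq> X \<and> (\<forall>i\<in>{1..n}. \<gamma> ` {t (i - 1)..t i} \<subseteq> U i) \<and>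
          (\<forall>i\<in>{0..n}. \<gamma> (t i) = reversepath h (t i)) \<and> homotopic_paths X \<gamma> (reversepath f)"
  proof (intro exI[of _ "reversepath \<gamma>"] conjI ballI subsetI)
    fix i y assume i: "i \<in> {1..n}" and y: "y \<in> reversepath \<gamma> ` {t (i - 1)..t i}"
    define j where "j = Suc n - i"
    have j: "j \<in> {1..n}" "n - (j - 1) = i" "n - j = i - 1" "Suc n - j = i"
      using i by (auto simp: j_def)
    from y obtain r where r: "y = \<gamma> (1 - r)" "r \<in> {t (i - 1)..t i}"
      by (auto simp: reversepath_def)
    then have "1 - r \<in> {s (j - 1)..s j}"
      using j by (auto simp: s_def)
    then have "\<gamma> (1 - r) \<in> V j"
      using g(3) j(1) by blast
    then show "y \<in> U i"
      using r j by (simp add: V_def)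
  next
    fix i assume "i \<in> {0..n}"
    then have "\<gamma> (s (n - i)) = h (s (n - i))" "s (n - i) = 1 - t i"
      using bspec[OF g(4), of "n - i"] by (auto simp: s_def)
    then show "reversepath \<gamma> (t i) = reversepath h (t i)"
      by (simp add: reversepath_def)
  qed (use g in \<open>auto simp: homotopic_paths_reversepath\<close>)
qed

lemma homotopically_close_join:
  assumes close: "homotopically_close X f h" "homotopically_close X f' h'"
    and fin: "pathfinish f = pathstart f'"
  shows "homotopically_close X (f +++ f') (h +++ h')"
  unfolding homotopically_close_def
proof (intro conjI allI impI)
  have hh: "h 1 = h' 0"
    using assms by (auto simp: homotopically_close_def pathstart_def pathfinish_def)
  show "path (f +++ f')" "path_image (f +++ f') \<subseteq> X" "path (h +++ h')" "path_image (h +++ h') \<subseteq> X"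
    "pathstart (f +++ f') = pathstart (h +++ h')" "pathfinish (f +++ f') = pathfinish (h +++ h')"
    using assms by (auto simp: homotopically_close_def path_image_join)
  fix n :: nat and t :: "nat \<Rightarrow> real" and U :: "nat \<Rightarrow> 'a set"
  assume A: "t 0 = 0 \<and> t n = 1 \<and> (\<forall>i\<in>{1..n}. t (i - 1) < t i) \<and>
        (\<forall>i\<in>{1..n}. openin (top_of_set X) (U i) \<and> (h +++ h') ` {t (i - 1)..t i} \<subseteq> U i)"
  have mono: "t i < t j" if "i < j" "j \<le> n" for i j
    using that
  proof (induction j)
    case (Suc j)
    have "t j < t (Suc j)"
      using A Suc.prems by (metis atLeastAtMost_iff diff_Suc_1 le_add1 plus_1_eq_Suc)
    with Suc show ?case
      by (cases "i = j") auto
  qed auto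
  have hhU: "(h +++ h') r \<in> U i" if "i \<in> {1..n}" "t (i - 1) \<le> r" "r \<le> t i" for i r
    using A that by (meson atLeastAtMost_iff image_subset_iff)
  define k where "k = (LEAST k. 1/2 \<le> t k)"
  have kn: "k \<le> n" and tk: "1/2 \<le> t k"
    unfolding k_def by (rule Least_le, use A in simp) (rule LeastI[of _ n], use A in simp)
  have tlk: "t i < 1/2" if "i < k" for i
    using not_less_Least[of i "\<lambda>k. 1/2 \<le> t k"] that by (auto simp: k_def not_le)
  have k1: "1 \<le> k"
    using tk A by (cases k) auto
  define m where "m = (if t k = 1/2 then k else k - 1)"
  have mn: "m < n"
    using kn k1 A by (cases "k = n") (auto simp: m_def)
  have tm: "t m \<le> 1/2"
    using tlk[of "k - 1"] k1 by (auto simp: m_def)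
  have tgm: "1/2 < t i" if "m < i" "i \<le> n" for i
  proof (cases "t k = 1/2")
    case True
    then show ?thesis using mono[of k i] that by (simp add: m_def)
  next
    case False
    then have "k \<le> i" using that k1 by (simp add: m_def)
    then show ?thesis using False tk mono[of k i] that by (cases "k = i") auto
  qed

  define s where "s i = (if i < k then 2 * t i else 1)" for i
  have s: "s 0 = 0 \<and> s k = 1 \<and> (\<forall>i\<in>{1..k}. s (i - 1) < s i)"
  proof (intro conjI ballI)
    fix i assume i: "i \<in> {1..k}"
    then show "s (i - 1) < s i"
      using mono[of "i - 1" i] tlk[of "i - 1"] kn by (auto simp: s_def)
  qed (use A k1 in \<open>auto simp: s_def\<close>)
  have U: "openin (top_of_set X) (U i) \<and> h ` {s (i - 1)..s i} \<subseteq> U i" if i: "i \<in> {1..k}" for i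
  proof -
    have "h r \<in> U i" if "r \<in> {s (i - 1)..s i}" for r
    proof -
      have "t (i - 1) \<le> r / 2" "r / 2 \<le> t i" "r / 2 \<le> 1/2"
        using that i tk tlk[of i] by (auto simp: s_def split: if_splits)
      then show ?thesis
        using hhU[of i "r / 2"] i kn by (auto simp: joinpaths_def)
    qed
    then show ?thesis using A i kn by auto
  qed
  then have allU: "\<forall>i\<in>{1..k}. openin (top_of_set X) (U i) \<and> h ` {s (i - 1)..s i} \<subseteq> U i"
    by blast
  obtain \<gamma> where g: "path \<gamma>" "path_image \<gamma> \<subseteq> X" "\<forall>i\<in>{1..k}. \<gamma> ` {s (i - 1)..s i} \<subseteq> U i"
      "\<forall>i\<in>{0..k}. \<gamma> (s i) = h (s i)" "homotopic_paths X \<gamma> f"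
    using homotopically_closeD[of X f h s k U, OF close(1) s allU]
    by (elim exE conjE) (rule that)

  define s' where "s' i = (if i = 0 then 0 else 2 * t (m + i) - 1)" for i
  have s': "s' 0 = 0 \<and> s' (n - m) = 1 \<and> (\<forall>i\<in>{1..n-m}. s' (i - 1) < s' i)"
  proof (intro conjI ballI)
    fix i assume i: "i \<in> {1..n-m}"
    then have "m + i \<le> n" by auto
    with i show "s' (i - 1) < s' i"
      using mono[of "m + (i - 1)" "m + i"] tgm[of "m + i"] by (auto simp: s'_def)
  qed (use A mn in \<open>auto simp: s'_def\<close>)
  have hjoin: "(h +++ h') ((r + 1) / 2) = h' r" if "0 \<le> r" for r
  proof (cases "r = 0")
    case False
    with that have "\<not> (r + 1) / 2 \<le> 1/2" "2 * ((r + 1) / 2) - 1 = r"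
      by (simp_all add: field_simps)
    then show ?thesis by (simp only: joinpaths_def if_False)
  qed (use hh in \<open>simp add: joinpaths_def\<close>)
  have U': "openin (top_of_set X) (U (m + i)) \<and> h' ` {s' (i - 1)..s' i} \<subseteq> U (m + i)"
    if i: "i \<in> {1..n-m}" for i
  proof -
    have "h' r \<in> U (m + i)" if "r \<in> {s' (i - 1)..s' i}" for r
    proof -
      obtain j where j: "i = Suc j"
        using i by (cases i) auto
      have "t (m + j) \<le> (r + 1) / 2" "(r + 1) / 2 \<le> t (m + i)" "0 \<le> r"
      proof -
        show "(r + 1) / 2 \<le> t (m + i)"
          using that i by (simp add: s'_def)
        show "t (m + j) \<le> (r + 1) / 2" "0 \<le> r"
          using that i tm tgm[of "m + j"] by (cases "j = 0"; force simp: s'_def j)+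
      qed
      then have "t (m + i - 1) \<le> (r + 1) / 2" "(r + 1) / 2 \<le> t (m + i)" "0 \<le> r"
        by (simp_all add: j)
      then show ?thesis
        using hhU[of "m + i" "(r + 1) / 2"] i hjoin \<open>0 \<le> r\<close> by auto
    qed
    then show ?thesis using A i by auto
  qed
  then have allU': "\<forall>i\<in>{1..n-m}. openin (top_of_set X) (U (m + i)) \<and> h' ` {s' (i - 1)..s' i} \<subseteq> U (m + i)"
    by blast
  obtain \<gamma>' where g': "path \<gamma>'" "path_image \<gamma>' \<subseteq> X"
      "\<forall>i\<in>{1..n-m}. \<gamma>' ` {s' (i - 1)..s' i} \<subseteq> U (m + i)"
      "\<forall>i\<in>{0..n-m}. \<gamma>' (s' i) = h' (s' i)" "homotopic_paths X \<gamma>' f'"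
    using homotopically_closeD[of X f' h' s' "n - m" "\<lambda>i. U (m + i)", OF close(2) s' allU']
    by (elim exE conjE) (rule that)

  have ends: "\<gamma> 1 = h 1" "\<gamma>' 0 = h' 0"
    using bspec[OF g(4), of k] bspec[OF g'(4), of 0] s s' by simp_all
  show "\<exists>\<gamma>. path \<gamma> \<and> path_image \<gamma> \<subseteq> X \<and> (\<forall>i\<in>{1..n}. \<gamma> ` {t (i - 1)..t i} \<subseteq> U i) \<and>
          (\<forall>i\<in>{0..n}. \<gamma> (t i) = (h +++ h') (t i)) \<and> homotopic_paths X \<gamma> (f +++ f')"
  proof (intro exI[of _ "\<gamma> +++ \<gamma>'"] conjI ballI subsetI)
    show "path (\<gamma> +++ \<gamma>')"
      using g(1) g'(1) ends hh by (simp add: pathstart_def pathfinish_def)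
    show "z \<in> X" if "z \<in> path_image (\<gamma> +++ \<gamma>')" for z
      using that g(2) g'(2) path_image_join_subset[of \<gamma> \<gamma>'] by blast
    show "homotopic_paths X (\<gamma> +++ \<gamma>') (f +++ f')"
      using g(5) g'(5) ends hh by (intro homotopic_paths_join) (auto simp: pathstart_def pathfinish_def)
  next
    fix i y assume i: "i \<in> {1..n}" and "y \<in> (\<gamma> +++ \<gamma>') ` {t (i - 1)..t i}"
    then obtain r where r: "y = (\<gamma> +++ \<gamma>') r" "t (i - 1) \<le> r" "r \<le> t i"
      by auto
    consider "r < 1/2" | "r = 1/2" | "1/2 < r" by linarith
    then show "y \<in> U i"
    proof cases
      case 1
      have ik: "i \<le> k"
      proof (rule ccontr)
        assume "\<not> i \<le> k"
        then have "k = i - 1 \<or> k < i - 1" "i - 1 \<le> n"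
          using i by auto
        then have "t k \<le> t (i - 1)"
          using mono[of k "i - 1"] by (metis less_eq_real_def)
        then show False using 1 r tk by simp
      qed
      then have "2 * r \<in> {s (i - 1)..s i}"
        using 1 r i by (auto simp: s_def)
      then have "\<gamma> (2 * r) \<in> U i"
        using bspec[OF g(3), of i] i ik by (simp add: image_subset_iff)
      then show ?thesis using r 1 by (simp add: joinpaths_def)
    next
      case 2
      then have "y = (h +++ h') r"
        using r(1) ends unfolding 2 by (simp add: joinpaths_def)
      then show ?thesis using hhU[OF i r(2,3)] by simp
    next
      case 3
      have "m < i"
      proof (rule ccontr)
        assume "\<not> m < i"
        then have "i = m \<or> i < m" "m \<le> n"
          using mn by auto
        then have "t i \<le> t m"
          using mono[of i m] by (metis less_eq_real_def)
        then show False using 3 r tm by simp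
      qed
      then obtain d where d: "i = m + Suc d"
        using less_imp_Suc_add by auto
      have "2 * r - 1 \<in> {s' d..s' (Suc d)}"
        using 3 r(2,3) by (simp add: s'_def d)
      then have "2 * r - 1 \<in> {s' (i - m - 1)..s' (i - m)}"
        by (simp add: d)
      moreover have "i - m \<in> {1..n-m}" "m + (i - m) = i"
        using d i by auto
      ultimately have "\<gamma>' (2 * r - 1) \<in> U i"
        using bspec[OF g'(3), of "i - m"] by (simp only: image_subset_iff)
      then show ?thesis using r 3 by (simp add: joinpaths_def)
    qed
  next
    fix i assume i: "i \<in> {0..n}"
    consider "i < k" | "k \<le> i" "i \<le> m" | "m < i"
      by linarith
    then show "(\<gamma> +++ \<gamma>') (t i) = (h +++ h') (t i)"
    proof cases
      case 1
      then have "\<gamma> (s i) = h (s i)" using g(4) by auto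
      then show ?thesis using 1 tlk[of i] by (simp add: joinpaths_def s_def)
    next
      case 2
      then have ti: "t i = 1/2" using tk k1 by (auto simp: m_def split: if_splits)
      show ?thesis unfolding ti using ends by (simp add: joinpaths_def)
    next
      case 3
      then have "i - m \<in> {0..n-m}" "s' (i - m) = 2 * t i - 1" "1/2 < t i"
        using i tgm[of i] by (auto simp: s'_def)
      then show ?thesis using bspec[OF g'(4), of "i - m"] by (simp add: joinpaths_def)
    qed
  qed
qed

lemma quasi_small_loopsI:
  "f \<in> loops_at X x \<Longrightarrow> h \<in> loops_at X x \<Longrightarrow> path_class X h \<in> H \<Longrightarrow> homotopically_close X f h \<Longrightarrow>
    path_class X f \<in> quasi_small_loops X x H"
  unfolding quasi_small_loops_def by blast

lemma subgroup_quasi_small_loops: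
  assumes "x \<in> X" and H: "subgroup H (fundamental_group X x)"
  shows "subgroup (quasi_small_loops X x H) (fundamental_group X x)"
proof -
  interpret group "fundamental_group X x"
    using assms(1) by (rule group_fundamental_group)
  show ?thesis
  proof (rule subgroupI)
    show "quasi_small_loops X x H \<subseteq> carrier (fundamental_group X x)"
      by (auto simp: quasi_small_loops_def fundamental_group_def)
    have "path_class X (\<lambda>_. x) \<in> H"
      using subgroup.one_closed[OF H] by (simp add: fundamental_group_def)
    moreover have "homotopically_close X (\<lambda>_. x) (\<lambda>_. x)"
      using loops_at_const[OF assms(1)] by (intro homotopically_close_refl) (auto simp: loops_at_def)
    ultimately show "quasi_small_loops X x H \<noteq> {}"
      using loops_at_const[OF assms(1)] unfolding quasi_small_loops_def by blast
  next
    fix A assume "A \<in> quasi_small_loops X x H"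
    then obtain f h where fh: "A = path_class X f" "f \<in> loops_at X x" "h \<in> loops_at X x"
        "path_class X h \<in> H" "homotopically_close X f h"
      by (auto simp: quasi_small_loops_def)
    have "path_class X (reversepath h) \<in> H"
      using subgroup.m_inv_closed[OF H fh(4)] fh(3) by (simp add: inv_path_class)
    then show "inv\<^bsub>fundamental_group X x\<^esub> A \<in> quasi_small_loops X x H"
      unfolding fh(1) inv_path_class[OF fh(2)]
      by (intro quasi_small_loopsI[of _ _ _ "reversepath h"] loops_at_reversepath
            homotopically_close_reversepath fh)
  next
    fix A B assume "A \<in> quasi_small_loops X x H" "B \<in> quasi_small_loops X x H"
    then obtain f h f' h' where fh: "A = path_class X f" "f \<in> loops_at X x" "h \<in> loops_at X x"
        "path_class X h \<in> H" "homotopically_close X f h"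
      and fh': "B = path_class X f'" "f' \<in> loops_at X x" "h' \<in> loops_at X x"
        "path_class X h' \<in> H" "homotopically_close X f' h'"
      by (auto simp: quasi_small_loops_def)
    have "path_class X (h +++ h') \<in> H"
      using subgroup.m_closed[OF H fh(4) fh'(4)] fh(3) fh'(3) by (simp add: mult_path_class)
    moreover have "homotopically_close X (f +++ f') (h +++ h')"
      using fh fh' by (intro homotopically_close_join) (auto simp: loops_at_def)
    ultimately show "A \<otimes>\<^bsub>fundamental_group X x\<^esub> B \<in> quasi_small_loops X x H"
      unfolding fh(1) fh'(1) mult_path_class[OF fh(2) fh'(2)]
      by (intro quasi_small_loopsI[of _ _ _ "h +++ h'"] loops_at_join fh fh')
  qed
qed

lemma group_quasi_small_loop_group:
  assumes "x \<in> X" "subgroup H (fundamental_group X x)"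
  shows "group (quasi_small_loop_group X x H)"
  unfolding quasi_small_loop_group_def
  using subgroup.subgroup_is_group[OF subgroup_quasi_small_loops group_fundamental_group] assms
  by blast

end

theory Submission
  imports Defs
begin

text \<open>
  Conjugation by \<open>l\<close> is the classical change of base point: it is compatible with the products of
  loop classes, and conjugation by the reverse path undoes it. Closeness survives concatenation
  (\<open>homotopically_close_join\<close>) and every path is close to itself, so a loop \<open>f\<close> that is close to
  \<open>h\<close> has a conjugate that is close to the conjugate of \<open>h\<close>
  (\<open>homotopically_close_conjugate\<close>). Hence conjugation by \<open>l\<close> sends \<open>H\<close>-quasi-small classes to
  quasi-small classes of the conjugate of \<open>H\<close>. The same statement for the reverse path, applied to
  the conjugate of \<open>H\<close>, sends these back, since \<open>H\<close> consists of loop classes and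
  conjugating it there and back gives \<open>H\<close> (\<open>conjugate_by_path_reversepath\<close>); so the two maps are
  mutually inverse bijections (\<open>bij_betw_transport_quasi_small_loops\<close>).

  The case of quasi-small loop groups is \<open>H = {1}\<close>, whose conjugate is again trivial
  (\<open>conjugate_by_path_trivial\<close>).
\<close>

section \<open>Conjugating loops by a path\<close>

abbreviation conjugate :: "(real \<Rightarrow> 'a::topological_space) \<Rightarrow> (real \<Rightarrow> 'a) \<Rightarrow> real \<Rightarrow> 'a" where
  "conjugate l f \<equiv> reversepath l +++ (f +++ l)"

lemma homotopic_paths_cancel_left:
  assumes l: "path l" "path_image l \<subseteq> X" and f: "path f" "path_image f \<subseteq> X"
    and "pathstart f = pathstart l"
  shows "homotopic_paths X (l +++ (reversepath l +++ f)) f"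
proof -
  have "homotopic_paths X (l +++ (reversepath l +++ f)) ((l +++ reversepath l) +++ f)"
    using assms by (intro homotopic_paths_assoc) auto
  also have "homotopic_paths X ((l +++ reversepath l) +++ f) ((\<lambda>_. pathstart f) +++ f)"
    using assms homotopic_paths_linv_const[of "reversepath l" X "pathstart f"]
    by (intro homotopic_paths_join) auto
  also have "homotopic_paths X ((\<lambda>_. pathstart f) +++ f) f"
    using f by (intro homotopic_paths_lid_const) auto
  finally (homotopic_paths_trans) show ?thesis .
qed

lemma homotopic_paths_cancel_right:
  assumes l: "path l" "path_image l \<subseteq> X" and f: "path f" "path_image f \<subseteq> X"
    and "pathfinish f = pathstart l"
  shows "homotopic_paths X ((f +++ l) +++ reversepath l) f"
proof -
  have "homotopic_paths X ((f +++ l) +++ reversepath l) (f +++ (l +++ reversepath l))"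
    using assms by (intro homotopic_paths_sym[OF homotopic_paths_assoc]) auto
  also have "homotopic_paths X (f +++ (l +++ reversepath l)) (f +++ (\<lambda>_. pathfinish f))"
    using assms homotopic_paths_linv_const[of "reversepath l" X "pathfinish f"]
    by (intro homotopic_paths_join) auto
  also have "homotopic_paths X (f +++ (\<lambda>_. pathfinish f)) f"
    using f by (intro homotopic_paths_rid_const) auto
  finally (homotopic_paths_trans) show ?thesis .
qed

lemma conjugate_in_loops_at:
  assumes "path l" "path_image l \<subseteq> X" "pathstart l = x" "pathfinish l = y" "f \<in> loops_at X x"
  shows "conjugate l f \<in> loops_at X y"
  using assms by (auto simp: loops_at_def path_image_join)

text \<open>
  Both copies of \<open>l\<close> and its reverse cancel, the right-hand pair first.
\<close>

lemma conjugate_reversepath_conjugate: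
  assumes l: "path l" "path_image l \<subseteq> X" "pathstart l = x" and f: "f \<in> loops_at X x"
  shows "homotopic_paths X (conjugate (reversepath l) (conjugate l f)) f"
proof -
  have "homotopic_paths X (conjugate l f +++ reversepath l)
      (reversepath l +++ ((f +++ l) +++ reversepath l))"
    using assms
    by (intro homotopic_paths_sym[OF homotopic_paths_assoc]) (auto simp: loops_at_def path_image_join)
  also have "homotopic_paths X \<dots> (reversepath l +++ f)"
    using assms by (intro homotopic_paths_join homotopic_paths_cancel_right) (auto simp: loops_at_def)
  finally (homotopic_paths_trans)
  have inner: "homotopic_paths X (conjugate l f +++ reversepath l) (reversepath l +++ f)" .
  have "homotopic_paths X (l +++ (conjugate l f +++ reversepath l)) (l +++ (reversepath l +++ f))"
    using assms by (intro homotopic_paths_join[OF _ inner]) auto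
  also have "homotopic_paths X \<dots> f"
    using assms by (intro homotopic_paths_cancel_left) (auto simp: loops_at_def)
  finally (homotopic_paths_trans) show ?thesis
    by simp
qed

text \<open>
  The \<open>l\<close> that ends the first conjugate cancels against the reverse of \<open>l\<close> that begins the second.
\<close>

lemma conjugate_join:
  assumes l: "path l" "path_image l \<subseteq> X" "pathstart l = x"
    and fg: "f \<in> loops_at X x" "g \<in> loops_at X x"
  shows "homotopic_paths X (conjugate l f +++ conjugate l g) (conjugate l (f +++ g))"
proof -
  have "homotopic_paths X ((f +++ l) +++ (reversepath l +++ (g +++ l)))
      (f +++ (l +++ (reversepath l +++ (g +++ l))))"
    using assms
    by (intro homotopic_paths_sym[OF homotopic_paths_assoc]) (auto simp: loops_at_def path_image_join)
  also have "homotopic_paths X \<dots> (f +++ (g +++ l))"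
    using assms
    by (intro homotopic_paths_join homotopic_paths_cancel_left) (auto simp: loops_at_def path_image_join)
  also have "homotopic_paths X \<dots> ((f +++ g) +++ l)"
    using assms by (intro homotopic_paths_assoc) (auto simp: loops_at_def)
  finally (homotopic_paths_trans)
  have inner: "homotopic_paths X ((f +++ l) +++ conjugate l g) ((f +++ g) +++ l)" .
  have "homotopic_paths X (conjugate l f +++ conjugate l g)
      (reversepath l +++ ((f +++ l) +++ conjugate l g))"
    using assms
    by (intro homotopic_paths_sym[OF homotopic_paths_assoc]) (auto simp: loops_at_def path_image_join)
  also have "homotopic_paths X \<dots> (conjugate l (f +++ g))"
    using assms by (intro homotopic_paths_join[OF _ inner]) (auto simp: loops_at_def)
  finally (homotopic_paths_trans) show ?thesis .
qed

lemma conjugate_cong: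
  assumes "path l" "path_image l \<subseteq> X" "pathstart l = x" "f \<in> loops_at X x" "homotopic_paths X f g"
  shows "homotopic_paths X (conjugate l f) (conjugate l g)"
  using assms homotopic_paths_imp_pathfinish[of X f g] homotopic_paths_imp_pathstart[of X f g]
  by (intro homotopic_paths_join) (auto simp: loops_at_def)

lemma conjugate_const:
  assumes "path l" "path_image l \<subseteq> X" "pathstart l = x" "pathfinish l = y"
  shows "homotopic_paths X (conjugate l (\<lambda>_. x)) (\<lambda>_. y)"
proof -
  have "pathstart (\<lambda>_. x) = x"
    by (simp add: pathstart_def)
  then have "homotopic_paths X (conjugate l (\<lambda>_. x)) (reversepath l +++ l)"
    using assms by (intro homotopic_paths_join homotopic_paths_lid_const) auto
  also have "homotopic_paths X \<dots> (\<lambda>_. y)"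
    using assms by (intro homotopic_paths_linv_const) auto
  finally (homotopic_paths_trans) show ?thesis .
qed

text \<open>
  The outer paths are the same on both sides and each is close to itself, so closeness of
  concatenations applies twice.
\<close>

lemma homotopically_close_conjugate:
  assumes "path l" "path_image l \<subseteq> X" "pathstart l = x"
    and "f \<in> loops_at X x" "h \<in> loops_at X x" "homotopically_close X f h"
  shows "homotopically_close X (conjugate l f) (conjugate l h)"
  using assms
  by (intro homotopically_close_join homotopically_close_refl) (auto simp: loops_at_def)


section \<open>Change of base point on loop classes\<close>

text \<open>
  The union makes this a function of the class itself, total on all sets of paths; on the class of a
  loop at the start of \<open>l\<close> all members of the union coincide (\<open>transport_path_class\<close>). Totality
  matters because for an arbitrary set \<open>H\<close> the product of two \<open>H\<close>-quasi-small classes need not be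
  \<open>H\<close>-quasi-small, and a homomorphism still has to be evaluated there.
\<close>

definition transport ::
    "'a::topological_space set \<Rightarrow> (real \<Rightarrow> 'a) \<Rightarrow> (real \<Rightarrow> 'a) set \<Rightarrow> (real \<Rightarrow> 'a) set" where
  "transport X l A = (\<Union>f\<in>A. path_class X (conjugate l f))"

lemma transport_path_class:
  assumes "path l" "path_image l \<subseteq> X" "pathstart l = x" "f \<in> loops_at X x"
  shows "transport X l (path_class X f) = path_class X (conjugate l f)"
proof -
  have "path_class X (conjugate l g) = path_class X (conjugate l f)" if "g \<in> path_class X f" for g
    using that assms by (metis conjugate_cong mem_Collect_eq path_class_cong path_class_def)
  moreover have "f \<in> path_class X f"
    using assms by (auto simp: path_class_def loops_at_def)
  ultimately show ?thesis
    unfolding transport_def by blast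
qed

lemma transport_reversepath_transport:
  assumes "path l" "path_image l \<subseteq> X" "pathstart l = x" "pathfinish l = y"
    and "A \<in> carrier (fundamental_group X x)"
  shows "transport X (reversepath l) (transport X l A) = A"
proof -
  obtain f where f: "f \<in> loops_at X x" "A = path_class X f"
    using assms(5) by (auto simp: fundamental_group_def)
  have "transport X (reversepath l) (transport X l A)
      = path_class X (conjugate (reversepath l) (conjugate l f))"
    using assms f conjugate_in_loops_at[of l X x y f] transport_path_class[of l X x f]
      transport_path_class[of "reversepath l" X y "conjugate l f"] by simp
  then show ?thesis
    using assms f path_class_cong[OF conjugate_reversepath_conjugate[of l X x f]] by simp
qed

lemma transport_mult:
  assumes "path l" "path_image l \<subseteq> X" "pathstart l = x" "pathfinish l = y"
    and "A \<in> carrier (fundamental_group X x)" "B \<in> carrier (fundamental_group X x)"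
  shows "transport X l (A \<otimes>\<^bsub>fundamental_group X x\<^esub> B) =
      transport X l A \<otimes>\<^bsub>fundamental_group X y\<^esub> transport X l B"
proof -
  obtain f g where fg: "f \<in> loops_at X x" "A = path_class X f" "g \<in> loops_at X x" "B = path_class X g"
    using assms(5,6) by (auto simp: fundamental_group_def)
  have "path_class X (conjugate l f +++ conjugate l g) = path_class X (conjugate l (f +++ g))"
    using assms fg by (intro path_class_cong conjugate_join) auto
  then show ?thesis
    using assms fg
    by (simp add: mult_path_class[of _ _ x] mult_path_class[of _ _ y]
        transport_path_class[of _ _ x] loops_at_join conjugate_in_loops_at)
qed

lemma conjugate_by_path_eq_transport:
  assumes "path l" "path_image l \<subseteq> X" "pathstart l = x"
    and "H \<subseteq> carrier (fundamental_group X x)"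
  shows "conjugate_by_path X x l H = transport X l ` H"
proof -
  have "H = path_class X ` {h \<in> loops_at X x. path_class X h \<in> H}"
    using assms(4) by (auto simp: fundamental_group_def)
  then have "transport X l ` H = (\<lambda>h. transport X l (path_class X h)) ` {h \<in> loops_at X x. path_class X h \<in> H}"
    by (metis image_image)
  also have "\<dots> = (\<lambda>h. path_class X (conjugate l h)) ` {h \<in> loops_at X x. path_class X h \<in> H}"
    using assms by (intro image_cong) (auto simp: transport_path_class)
  also have "\<dots> = conjugate_by_path X x l H"
    by (auto simp: conjugate_by_path_def)
  finally show ?thesis ..
qed

lemma conjugate_by_path_subset_carrier:
  assumes "path l" "path_image l \<subseteq> X" "pathstart l = x" "pathfinish l = y"
  shows "conjugate_by_path X x l H \<subseteq> carrier (fundamental_group X y)"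
  using assms by (auto simp: conjugate_by_path_def fundamental_group_def intro!: imageI conjugate_in_loops_at)

lemma conjugate_by_path_reversepath:
  assumes "path l" "path_image l \<subseteq> X" "pathstart l = x" "pathfinish l = y"
    and "H \<subseteq> carrier (fundamental_group X x)"
  shows "conjugate_by_path X y (reversepath l) (conjugate_by_path X x l H) = H"
proof -
  have "conjugate_by_path X y (reversepath l) (conjugate_by_path X x l H) =
      (\<lambda>A. transport X (reversepath l) (transport X l A)) ` H"
    using assms conjugate_by_path_eq_transport[of l X x H]
      conjugate_by_path_eq_transport[of "reversepath l" X y "conjugate_by_path X x l H"]
      conjugate_by_path_subset_carrier[of l X x y H]
    by (simp add: image_image)
  also have "\<dots> = (\<lambda>A. A) ` H"
    using assms by (intro image_cong) (auto simp: transport_reversepath_transport)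
  finally show ?thesis
    by simp
qed

lemma conjugate_by_path_trivial:
  assumes "path l" "path_image l \<subseteq> X" "pathstart l = x" "pathfinish l = y"
  shows "conjugate_by_path X x l {path_class X (\<lambda>_. x)} = {path_class X (\<lambda>_. y)}"
proof -
  have x: "(\<lambda>_. x) \<in> loops_at X x"
    using assms(2,3) by (intro loops_at_const) auto
  then have "conjugate_by_path X x l {path_class X (\<lambda>_. x)} = {path_class X (conjugate l (\<lambda>_. x))}"
    using assms conjugate_by_path_eq_transport[of l X x "{path_class X (\<lambda>_. x)}"]
    by (simp add: fundamental_group_def transport_path_class)
  then show ?thesis
    using path_class_cong[OF conjugate_const[OF assms]] by simp
qed


section \<open>Quasi-small loops and the change of base point\<close>

lemma quasi_small_loops_subset_carrier:
  "quasi_small_loops X x H \<subseteq> carrier (fundamental_group X x)"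
  by (auto simp: quasi_small_loops_def fundamental_group_def)

lemma transport_quasi_small_loops:
  assumes "path l" "path_image l \<subseteq> X" "pathstart l = x" "pathfinish l = y"
    and "A \<in> quasi_small_loops X x H"
  shows "transport X l A \<in> quasi_small_loops X y (conjugate_by_path X x l H)"
proof -
  obtain f h where fh: "A = path_class X f" "f \<in> loops_at X x" "h \<in> loops_at X x"
      "path_class X h \<in> H" "homotopically_close X f h"
    using assms(5) by (auto simp: quasi_small_loops_def)
  have "path_class X (conjugate l h) \<in> conjugate_by_path X x l H"
    using fh by (auto simp: conjugate_by_path_def)
  then have "path_class X (conjugate l f) \<in> quasi_small_loops X y (conjugate_by_path X x l H)"
    using assms fh
    by (intro quasi_small_loopsI[of _ _ _ "conjugate l h"] conjugate_in_loops_at[of l X x]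
        homotopically_close_conjugate[of l X x]) auto
  then show ?thesis
    using assms fh by (simp add: transport_path_class)
qed

lemma bij_betw_transport_quasi_small_loops:
  assumes l: "path l" "path_image l \<subseteq> X" "pathstart l = x" "pathfinish l = y"
    and H: "H \<subseteq> carrier (fundamental_group X x)"
  shows "bij_betw (transport X l) (quasi_small_loops X x H)
      (quasi_small_loops X y (conjugate_by_path X x l H))"
proof (rule bij_betw_byWitness[where f' = "transport X (reversepath l)"])
  have rl: "path (reversepath l)" "path_image (reversepath l) \<subseteq> X"
      "pathstart (reversepath l) = y" "pathfinish (reversepath l) = x"
    using l by auto
  show "\<forall>A\<in>quasi_small_loops X x H. transport X (reversepath l) (transport X l A) = A"
    using transport_reversepath_transport[OF l] quasi_small_loops_subset_carrier by blast
  show "\<forall>A\<in>quasi_small_loops X y (conjugate_by_path X x l H).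
      transport X l (transport X (reversepath l) A) = A"
    using transport_reversepath_transport[OF rl] quasi_small_loops_subset_carrier by fastforce
  show "transport X l ` quasi_small_loops X x H
      \<subseteq> quasi_small_loops X y (conjugate_by_path X x l H)"
    using transport_quasi_small_loops[OF l] by blast
  show "transport X (reversepath l) ` quasi_small_loops X y (conjugate_by_path X x l H)
      \<subseteq> quasi_small_loops X x H"
    using transport_quasi_small_loops[OF rl, where H = "conjugate_by_path X x l H"]
    by (auto simp: conjugate_by_path_reversepath[OF l H])
qed

text \<open>
  The multiplication on both sides is that of the ambient fundamental group, so compatibility with
  products is inherited from \<open>transport_mult\<close> whether or not the carriers are closed under it.
\<close>

lemma quasi_small_loop_group_iso_conjugate:
  assumes l: "path l" "path_image l \<subseteq> X" "pathstart l = x" "pathfinish l = y"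
    and H: "H \<subseteq> carrier (fundamental_group X x)"
  shows "quasi_small_loop_group X x H \<cong> quasi_small_loop_group X y (conjugate_by_path X x l H)"
proof (rule is_isoI)
  show "transport X l
      \<in> iso (quasi_small_loop_group X x H) (quasi_small_loop_group X y (conjugate_by_path X x l H))"
    using bij_betw_transport_quasi_small_loops[OF assms] transport_quasi_small_loops[OF l]
      transport_mult[OF l] quasi_small_loops_subset_carrier[of X x H]
    by (auto simp: iso_def hom_def quasi_small_loop_group_def subset_iff)
qed


section \<open>Independence of the base point\<close>

theorem proposition3p6:
  fixes X :: "'a::topological_space set" and x y :: 'a
    and H :: "(real \<Rightarrow> 'a) set set" and l :: "real \<Rightarrow> 'a"
  assumes "path_connected X"
    and "H \<subseteq> carrier (fundamental_group X x)"
    and "path l" "path_image l \<subseteq> X" "pathstart l = x" "pathfinish l = y"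
  shows "quasi_small_loop_group X x H \<cong> quasi_small_loop_group X y (conjugate_by_path X x l H) \<and>
    (\<forall>a b. path_component X a b \<longrightarrow>
       quasi_small_loop_group X a {path_class X (\<lambda>_. a)} \<cong>
       quasi_small_loop_group X b {path_class X (\<lambda>_. b)})"
proof (intro conjI allI impI)
  show "quasi_small_loop_group X x H \<cong> quasi_small_loop_group X y (conjugate_by_path X x l H)"
    using assms by (intro quasi_small_loop_group_iso_conjugate)
next
  fix a b assume "path_component X a b"
  then obtain p where p: "path p" "path_image p \<subseteq> X" "pathstart p = a" "pathfinish p = b"
    by (auto simp: path_component_def)
  then have "{path_class X (\<lambda>_. a)} \<subseteq> carrier (fundamental_group X a)"
    using loops_at_const[of a X] by (auto simp: fundamental_group_def)
  from quasi_small_loop_group_iso_conjugate[OF p this]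
  show "quasi_small_loop_group X a {path_class X (\<lambda>_. a)} \<cong>
      quasi_small_loop_group X b {path_class X (\<lambda>_. b)}"
    by (simp add: conjugate_by_path_trivial[OF p])
qed

end
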